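(* Suppose that $K\subset\mathbb{R}^d$, $d\geq 2$, is a set of diameter $1$ and that $K$ is almost flat at every point $x\in K$ with parameters $\lambda,\kappa,\beta_0\in(0,1)$ that do not depend on $x\in K$. Then $$\dim_H(K)\leq 1+c'\lambda^{-4}\left(1-\kappa+\beta_0^2\,\kappa\right),$$ where $c'$ is a universal constant.
   Context: $\dim_H$ is the Hausdorff dimension. For a bounded set $K\subset\mathbb{R}^d$, $x\in K$ and $r>0$, $$\beta_K(x,r):=\inf_L\ \sup_{z\in K\cap B(x,r)}\frac{\operatorname{dist}(z,L)}{r},$$ where the infimum is over all lines $L$ in $\mathbb{R}^d$ and $B(x,r)$ is the ball of center $x$ and radius $r$. A set $K\subset\mathbb{R}^d$ is almost flat at a point $x\in K$ with parameters $\lambda,\kappa,\beta_0\in(0,1)$ if there is a strictly increasing sequence of positive integers $(N_i)$ such that for every $i\in\mathbb{N}$ the number of flat scales $\lambda^m$, with integers $0\leq m<N_i$, is greater than $\kappa N_i$. A scale $\lambda^m$ is flat if $\beta_K(x,\lambda^m)\leq\beta_0$.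
   Formalization: The constant c' is allowed to depend on the dimension d (but not on K, λ, κ, β₀), since a constant independent of d is impossible: products C^d of suitable Cantor sets with λ=1/2, κ=1/3, β₀=1/10 have dimension d/2. *)

theory Defs
  imports "HOL-Analysis.Analysis"
begin

text \<open>
  Hausdorff measure and dimension. The gauge uses the conventions that the empty set contributes
  0 for every exponent and that \<open>0\<^sup>0 = 1\<close> for nonempty sets; they have to be spelled out
  because \<^term>\<open>0 powr 0 = (0::real)\<close> in the library.
\<close>

definition hausdorff_gauge :: "real \<Rightarrow> 'a::metric_space set \<Rightarrow> ennreal" where
  "hausdorff_gauge s U =
     (if U = {} then 0 else if s = 0 then 1 else ennreal (diameter U powr s))"

text \<open>
  Boundedness is required explicitly since \<^const>\<open>diameter\<close> is meaningless on unbounded sets.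
\<close>

definition hausdorff_covers :: "real \<Rightarrow> 'a::metric_space set \<Rightarrow> (nat \<Rightarrow> 'a set) set" where
  "hausdorff_covers \<delta> A =
     {U. A \<subseteq> (\<Union>i. U i) \<and> (\<forall>i. bounded (U i) \<and> diameter (U i) \<le> \<delta>)}"

definition hausdorff_measure :: "real \<Rightarrow> 'a::metric_space set \<Rightarrow> ennreal" where
  "hausdorff_measure s A =
     (SUP \<delta>\<in>{0<..}. INF U\<in>hausdorff_covers \<delta> A. \<Sum>i. hausdorff_gauge s (U i))"

definition hausdorff_dim :: "'a::metric_space set \<Rightarrow> ereal" where
  "hausdorff_dim A = (INF s\<in>{s. 0 \<le> s \<and> hausdorff_measure s A = 0}. ereal s)"

definition lines :: "'a::euclidean_space set set" where
  "lines = {L. affine L \<and> aff_dim L = 1}"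

text \<open>
  For \<open>x \<in> K\<close> and \<open>r > 0\<close>, the only case of interest, the supremum is over a nonempty
  bounded set of nonnegative reals.
\<close>

definition beta_number :: "'a::euclidean_space set \<Rightarrow> 'a \<Rightarrow> real \<Rightarrow> real" where
  "beta_number K x r = (INF L\<in>lines. SUP z\<in>K \<inter> ball x r. infdist z L / r)"

definition flat_scale :: "'a::euclidean_space set \<Rightarrow> 'a \<Rightarrow> real \<Rightarrow> real \<Rightarrow> bool" where
  "flat_scale K x \<beta>\<^sub>0 r \<longleftrightarrow> beta_number K x r \<le> \<beta>\<^sub>0"

definition almost_flat_at ::
  "'a::euclidean_space set \<Rightarrow> 'a \<Rightarrow> real \<Rightarrow> real \<Rightarrow> real \<Rightarrow> bool" where
  "almost_flat_at K x \<Lambda> \<kappa> \<beta>\<^sub>0 \<longleftrightarrow>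
     (\<exists>N :: nat \<Rightarrow> nat. strict_mono N \<and> (\<forall>i. 0 < N i) \<and>
        (\<forall>i. real (card {m. m < N i \<and> flat_scale K x \<beta>\<^sub>0 (\<Lambda> ^ m)}) > \<kappa> * real (N i)))"

end

theory Submission
  imports Defs
begin

text \<open>
  If a set \<open>Q\<close> of diameter \<open>D\<close> lies within distance \<open>b D\<close> of a line, cut it in two halves by
  projecting to the line. The diameters of the halves add up to at most \<open>(1 + C b\<^sup>2) D\<close>: either both
  halves are long and this is Pythagoras, or one of them is short and there is room to spare. At a
  scale that is bad for all points of \<open>Q\<close>, cut \<open>Q\<close> into \<open>M\<close> pieces, where \<open>M\<close> depends on the
  dimension only. Iterating over the scales \<open>(3/4)\<^sup>i\<close>, \<open>i < n\<close>, covers the points with at most \<open>t\<close> bad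
  scales by sets of diameter at most \<open>(3/4)\<^sup>n\<close> with sum of diameters at most \<open>M\<^sup>t (1 + C b\<^sup>2)\<^sup>n\<close>. For
  \<open>b\<close> of order \<open>\<beta>\<^sub>0/\<Lambda>\<close> and \<open>t\<close> of order \<open>(1 - \<kappa>) n/\<Lambda>\<close> every point of \<open>K\<close> is covered for infinitely
  many \<open>n\<close>, and the resulting series of \<open>s\<close>-th powers of diameters converges.
\<close>

definition splits :: "'a::metric_space set \<Rightarrow> real \<Rightarrow> bool" where
  "splits Q c \<longleftrightarrow> (\<exists>\<P>. finite \<P> \<and> \<Union>\<P> = Q \<and> (\<forall>P\<in>\<P>. diameter P \<le> 3/4 * diameter Q) \<and>
     (\<Sum>P\<in>\<P>. diameter P) \<le> c * diameter Q)"

definition cheap_cover :: "'a::metric_space set \<Rightarrow> real \<Rightarrow> real \<Rightarrow> bool" where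
  "cheap_cover E \<delta> c \<longleftrightarrow> (\<exists>F. finite F \<and> E \<subseteq> \<Union>F \<and> (\<forall>U\<in>F. bounded U \<and> diameter U \<le> \<delta>) \<and>
     (\<Sum>U\<in>F. diameter U) \<le> c)"

lemma splits_mono:
  assumes "splits Q c" "c \<le> c'" "bounded Q"
  shows "splits Q c'"
proof -
  have "c * diameter Q \<le> c' * diameter Q" using assms diameter_ge_0 by (intro mult_right_mono) auto
  with assms(1) show ?thesis unfolding splits_def by (elim exE conjE) (rule exI, auto)
qed

lemma cheap_cover_mono: "cheap_cover E \<delta> c \<Longrightarrow> E' \<subseteq> E \<Longrightarrow> c \<le> c' \<Longrightarrow> cheap_cover E' \<delta> c'"
  unfolding cheap_cover_def by (meson order_trans)

lemma cheap_cover_UN: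
  assumes "finite I" "\<And>i. i \<in> I \<Longrightarrow> cheap_cover (E i) \<delta> (c i)"
  shows "cheap_cover (\<Union>i\<in>I. E i) \<delta> (\<Sum>i\<in>I. c i)"
  using assms
proof (induction I rule: finite_induct)
  case empty
  then show ?case unfolding cheap_cover_def by (intro exI[of _ "{}"]) auto
next
  case (insert i I)
  obtain F where F: "finite F" "E i \<subseteq> \<Union>F" "\<forall>U\<in>F. bounded U \<and> diameter U \<le> \<delta>"
    "(\<Sum>U\<in>F. diameter U) \<le> c i"
    using insert.prems[of i] unfolding cheap_cover_def by auto
  obtain G where G: "finite G" "(\<Union>i\<in>I. E i) \<subseteq> \<Union>G" "\<forall>U\<in>G. bounded U \<and> diameter U \<le> \<delta>"
    "(\<Sum>U\<in>G. diameter U) \<le> (\<Sum>i\<in>I. c i)"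
    using insert.IH insert.prems unfolding cheap_cover_def by auto
  have "(\<Sum>U\<in>F \<union> G. diameter U) = (\<Sum>U\<in>F. diameter U) + (\<Sum>U\<in>G. diameter U) - (\<Sum>U\<in>F \<inter> G. diameter U)"
    using F(1) G(1) by (rule sum_Un)
  moreover have "0 \<le> (\<Sum>U\<in>F \<inter> G. diameter U)"
    using F(3) by (intro sum_nonneg) (auto intro: diameter_ge_0)
  ultimately have "(\<Sum>U\<in>F \<union> G. diameter U) \<le> c i + (\<Sum>i\<in>I. c i)"
    using F(4) G(4) by linarith
  with F G show ?case
    unfolding cheap_cover_def using insert.hyps by (intro exI[of _ "F \<union> G"]) auto
qed

text \<open>
  A piece whose diameter is already below the next scale waits there, so every scale contributes
  at most one splitting along each branch.
\<close>

lemma multiscale_cover: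
  fixes good :: "'a::metric_space \<Rightarrow> nat \<Rightarrow> bool"
  assumes K: "bounded K"
    and crude: "\<And>Q::'a set. bounded Q \<Longrightarrow> splits Q M"
    and flat: "\<And>Q x j. \<lbrakk>Q \<subseteq> K; x \<in> Q; good x j; (3/4)^(Suc j) < diameter Q; diameter Q \<le> (3/4)^j\<rbrakk>
                 \<Longrightarrow> splits Q B"
    and B: "B \<ge> 1" and M: "M \<ge> 1"
  shows "\<lbrakk>Q \<subseteq> K; diameter Q \<le> (3/4)^j\<rbrakk> \<Longrightarrow>
    cheap_cover {x\<in>Q. card {i\<in>{j..<j+n}. \<not> good x i} \<le> t} ((3/4)^(j+n)) (M^t * B^n * diameter Q)"
proof (induction n arbitrary: j t Q)
  case 0
  have "bounded Q" using 0 K bounded_subset by blast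
  then have "1 * diameter Q \<le> M^t * diameter Q"
    using M by (intro mult_right_mono) (auto intro: diameter_ge_0)
  then show ?case using 0 \<open>bounded Q\<close> unfolding cheap_cover_def by (intro exI[of _ "{Q}"]) auto
next
  case (Suc n)
  have bQ: "bounded Q" using Suc K bounded_subset by blast
  let ?c = "\<lambda>x j n. card {i\<in>{j..<j+n}. \<not> good x i}"
  have cnt: "?c x j (Suc n) = ?c x (Suc j) n + (if good x j then 0 else 1)" for x
  proof -
    have "{i\<in>{j..<j+Suc n}. \<not> good x i} =
        (if good x j then {} else {j}) \<union> {i\<in>{Suc j..<Suc j+n}. \<not> good x i}"
      by (auto simp: Suc_le_eq order.order_iff_strict)
    then show ?thesis by simp
  qed
  have split_step: "cheap_cover {x\<in>Q. ?c x (Suc j) n \<le> t'} ((3/4)^(j + Suc n)) (M^t' * B^n * (c * diameter Q))"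
    if c: "splits Q c" for c t'
  proof -
    obtain \<P> where P: "finite \<P>" "\<Union>\<P> = Q" "\<forall>P\<in>\<P>. diameter P \<le> 3/4 * diameter Q"
      "(\<Sum>P\<in>\<P>. diameter P) \<le> c * diameter Q"
      using c unfolding splits_def by metis
    have "cheap_cover {x\<in>P. ?c x (Suc j) n \<le> t'} ((3/4)^(Suc j + n)) (M^t' * B^n * diameter P)"
      if "P \<in> \<P>" for P
    proof (rule Suc.IH)
      show "P \<subseteq> K" using that P(2) Suc.prems(1) by auto
      show "diameter P \<le> (3/4)^Suc j" using bspec[OF P(3) that] Suc.prems(2) by simp
    qed
    then have "cheap_cover (\<Union>P\<in>\<P>. {x\<in>P. ?c x (Suc j) n \<le> t'}) ((3/4)^(Suc j + n))
        (\<Sum>P\<in>\<P>. M^t' * B^n * diameter P)"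
      using P(1) by (intro cheap_cover_UN)
    moreover have "(\<Sum>P\<in>\<P>. M^t' * B^n * diameter P) \<le> M^t' * B^n * (c * diameter Q)"
      unfolding sum_distrib_left[symmetric] using P(4) B M by (intro mult_left_mono) auto
    moreover have "{x\<in>Q. ?c x (Suc j) n \<le> t'} \<subseteq> (\<Union>P\<in>\<P>. {x\<in>P. ?c x (Suc j) n \<le> t'})"
      using P(2) by blast
    ultimately show ?thesis unfolding add_Suc_shift by (meson cheap_cover_mono)
  qed
  consider "diameter Q \<le> (3/4)^Suc j" | x where "x \<in> Q" "good x j" "(3/4)^Suc j < diameter Q"
    | "\<forall>x\<in>Q. \<not> good x j" by force
  then show ?case
  proof cases
    case 1
    have "cheap_cover {x\<in>Q. ?c x (Suc j) n \<le> t} ((3/4)^(j + Suc n)) (M^t * B^n * diameter Q)"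
      unfolding add_Suc_shift[symmetric] using Suc.IH Suc.prems 1 by blast
    moreover have "M^t * B^n * diameter Q \<le> M^t * B^Suc n * diameter Q"
      using B M bQ by (intro mult_mono power_increasing) (auto intro: diameter_ge_0)
    moreover have "{x\<in>Q. ?c x j (Suc n) \<le> t} \<subseteq> {x\<in>Q. ?c x (Suc j) n \<le> t}"
      unfolding cnt by auto
    ultimately show ?thesis by (meson cheap_cover_mono)
  next
    case 2
    then have "splits Q B" using flat Suc.prems by blast
    from split_step[OF this, of t] show ?thesis
    proof (rule cheap_cover_mono)
      show "{x\<in>Q. ?c x j (Suc n) \<le> t} \<subseteq> {x\<in>Q. ?c x (Suc j) n \<le> t}"
        unfolding cnt by auto
    qed (simp add: mult_ac)
  next
    case 3
    have B': "B^n \<le> B^Suc n" using B by (intro power_increasing) auto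
    show ?thesis
    proof (cases t)
      case 0
      then have "{x\<in>Q. ?c x j (Suc n) \<le> t} = {}" using 3 unfolding cnt by auto
      moreover have "0 \<le> M^t * B^Suc n * diameter Q"
        using B M bQ by (simp add: diameter_ge_0)
      ultimately show ?thesis unfolding cheap_cover_def by (intro exI[of _ "{}"]) auto
    next
      case (Suc t')
      have "M^t' * B^n * (M * diameter Q) \<le> M^t * B^Suc n * diameter Q"
        using mult_left_mono[OF B', of "M^t * diameter Q"] M bQ
        by (simp add: Suc diameter_ge_0 mult_ac)
      moreover have "{x\<in>Q. ?c x j (Suc n) \<le> t} \<subseteq> {x\<in>Q. ?c x (Suc j) n \<le> t'}"
        using 3 Suc unfolding cnt by auto
      ultimately show ?thesis using split_step[OF crude[OF bQ], of t'] by (meson cheap_cover_mono)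
    qed
  qed
qed

lemma crude_split:
  obtains M where "M \<ge> 1" "\<And>Q::'a::euclidean_space set. bounded Q \<Longrightarrow> splits Q M"
proof -
  obtain C :: "'a set" where C: "finite C" "cball 0 1 \<subseteq> (\<Union>c\<in>C. ball c (3/8))"
    using compact_cball[of "0::'a" 1] unfolding compact_eq_totally_bounded
    by (meson divide_pos_pos zero_less_numeral)
  have "splits Q (max 1 (real (card C)))" if Q: "bounded Q" for Q :: "'a set"
  proof (cases "diameter Q = 0")
    case True
    then show ?thesis unfolding splits_def by (intro exI[of _ "{Q}"]) auto
  next
    case False
    define D where "D = diameter Q"
    have D: "D > 0" using False Q diameter_ge_0[of Q] by (simp add: D_def)
    then obtain x0 where x0: "x0 \<in> Q" by (force simp: D_def diameter_def)
    define P where "P c = Q \<inter> (\<lambda>y. x0 + D *\<^sub>R y) ` ball c (3/8)" for c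
    have bP: "bounded (P c)" "P c \<subseteq> Q" for c using Q by (auto simp: P_def)
    have dP: "diameter (P c) \<le> 3/4 * D" for c
    proof (rule diameter_le)
      fix y z assume "y \<in> P c" "z \<in> P c"
      then obtain y' z' where y: "y = x0 + D *\<^sub>R y'" "z = x0 + D *\<^sub>R z'"
        and "dist c y' < 3/8" "dist c z' < 3/8" unfolding P_def ball_def by blast
      then have "norm (y' - z') \<le> 3/4"
        using dist_triangle_half_r[of c y' "3/4" z'] by (simp add: dist_norm less_imp_le)
      then have "D * norm (y' - z') \<le> D * (3/4)" using D by (intro mult_left_mono) auto
      also have "D * norm (y' - z') = norm (D *\<^sub>R (y' - z'))" using D by simp
      also have "D *\<^sub>R (y' - z') = y - z" by (simp add: y scaleR_diff_right)
      finally show "norm (y - z) \<le> 3/4 * D" by simp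
    qed (use D in auto)
    have "Q \<subseteq> \<Union>(P ` C)"
    proof
      fix y assume y: "y \<in> Q"
      have "dist x0 y \<le> D" using diameter_bounded_bound[OF Q x0 y] by (simp add: D_def)
      then have "norm ((y - x0) /\<^sub>R D) \<le> 1" using D by (simp add: dist_norm norm_minus_commute divide_le_eq flip: divide_inverse_commute)
      then have "(y - x0) /\<^sub>R D \<in> cball 0 1" by simp
      then obtain c where "c \<in> C" "(y - x0) /\<^sub>R D \<in> ball c (3/8)" using C(2) by blast
      moreover have "y = x0 + D *\<^sub>R ((y - x0) /\<^sub>R D)" using D by simp
      ultimately show "y \<in> \<Union>(P ` C)" using y unfolding P_def by blast
    qed
    then have "\<Union>(P ` C) = Q" using bP by auto
    moreover have "(\<Sum>S\<in>P ` C. diameter S) \<le> real (card (P ` C)) * D"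
      using bP Q by (intro sum_bounded_above) (auto simp: D_def intro: diameter_subset)
    then have "(\<Sum>S\<in>P ` C. diameter S) \<le> max 1 (real (card C)) * D"
      by (rule order_trans) (use D C card_image_le[OF C(1), of P] in \<open>auto intro!: mult_right_mono\<close>)
    ultimately show ?thesis
      unfolding splits_def using C(1) dP by (intro exI[of _ "P ` C"]) (auto simp: D_def)
  qed
  then show thesis by (intro that[of "max 1 (real (card C))"]) auto
qed

lemma lines_direction:
  assumes "L \<in> (lines :: 'a::euclidean_space set set)"
  obtains u where "norm u = 1"
    "\<And>z w h. \<lbrakk>infdist z L \<le> h; infdist w L \<le> h\<rbrakk> \<Longrightarrow> (norm (z - w))\<^sup>2 \<le> (z \<bullet> u - w \<bullet> u)\<^sup>2 + (2*h)\<^sup>2"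
proof -
  have L: "affine L" "collinear L" "L \<noteq> {}"
    using assms by (auto simp: lines_def collinear_aff_dim)
  then have cl: "closed L" by (metis affine_hull_eq closed_affine_hull)
  obtain v where v: "\<And>x y. x \<in> L \<Longrightarrow> y \<in> L \<Longrightarrow> \<exists>c. x - y = c *\<^sub>R v"
    using L(2) unfolding collinear_def by blast
  obtain e :: 'a where e: "norm e = 1" using vector_choose_size[of 1] by auto
  define u where "u = (if v = 0 then e else v /\<^sub>R norm v)"
  have u: "norm u = 1" using e by (auto simp: u_def)
  have vu: "v = norm v *\<^sub>R u" by (simp add: u_def)
  show thesis
  proof (rule that[OF u])
    fix z w h assume h: "infdist z L \<le> h" "infdist w L \<le> h"
    obtain z' where z': "z' \<in> L" "infdist z L = dist z z'" using infdist_attains_inf[OF cl L(3)] by blast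
    obtain w' where w': "w' \<in> L" "infdist w L = dist w w'" using infdist_attains_inf[OF cl L(3)] by blast
    obtain c where "z' - w' = c *\<^sub>R v" using v z' w' by blast
    then obtain t where t: "z' - w' = t *\<^sub>R u" using vu by (metis scaleR_scaleR)
    define d where "d = (z - z') - (w - w')"
    have "norm d \<le> norm (z - z') + norm (w - w')" unfolding d_def by (rule norm_triangle_ineq4)
    then have d: "norm d \<le> 2*h" using h z' w' by (simp add: dist_norm)
    have zw: "z - w = t *\<^sub>R u + d" using t by (simp add: d_def algebra_simps)
    have uu: "u \<bullet> u = 1" using u by (simp add: norm_eq_1)
    have "(norm (z - w))\<^sup>2 = t\<^sup>2 + 2*t*(d \<bullet> u) + (norm d)\<^sup>2"
      unfolding zw power2_norm_eq_inner by (simp add: inner_simps uu inner_commute power2_eq_square)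
    moreover have "z \<bullet> u - w \<bullet> u = t + d \<bullet> u"
      unfolding inner_diff_left[symmetric] zw by (simp add: inner_simps uu)
    ultimately have "(norm (z - w))\<^sup>2 - (z \<bullet> u - w \<bullet> u)\<^sup>2 = (norm d)\<^sup>2 - (d \<bullet> u)\<^sup>2"
      by (simp add: power2_eq_square algebra_simps)
    also have "\<dots> \<le> (norm d)\<^sup>2" by simp
    also have "\<dots> \<le> (2*h)\<^sup>2" using d by (intro power_mono) auto
    finally show "(norm (z - w))\<^sup>2 \<le> (z \<bullet> u - w \<bullet> u)\<^sup>2 + (2*h)\<^sup>2" by simp
  qed
qed

text \<open>
  If both halves are long, Pythagoras gives a quadratic error; if one of them is short, the
  gap in the projection outweighs the error.
\<close>

lemma half_lengths:
  fixes l1 l2 h D b :: real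
  assumes "0 \<le> l1" "0 \<le> l2" "l1 \<le> D/2" "l2 \<le> D/2" "l1 + l2 \<le> D" "D > 0"
    and "0 \<le> h" "h \<le> 4/3 * b * D" "0 \<le> b" "b \<le> 1/20"
  shows "sqrt (l1\<^sup>2 + (2*h)\<^sup>2) + sqrt (l2\<^sup>2 + (2*h)\<^sup>2) \<le> (1 + 400 * b\<^sup>2) * D"
proof -
  have lin: "sqrt (l\<^sup>2 + (2*h)\<^sup>2) \<le> l + 2*h" if "0 \<le> l" for l
    using that assms by (intro real_le_lsqrt) (auto simp: power2_eq_square algebra_simps)
  have quad: "sqrt (l\<^sup>2 + (2*h)\<^sup>2) \<le> l + 200 * b\<^sup>2 * D" if "D/10 \<le> l" for l
  proof (rule real_le_lsqrt)
    have "h\<^sup>2 \<le> (4/3 * b * D)\<^sup>2" using assms by (intro power_mono) auto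
    then have "(2*h)\<^sup>2 \<le> 2 * (D/10) * (200 * b\<^sup>2 * D)"
      using zero_le_square[of "b * D"] by (simp add: power2_eq_square mult_ac)
    also have "\<dots> \<le> 2 * l * (200 * b\<^sup>2 * D)" using that assms by (intro mult_mono) auto
    also have "\<dots> \<le> 2 * l * (200 * b\<^sup>2 * D) + (200 * b\<^sup>2 * D)\<^sup>2" by simp
    finally show "l\<^sup>2 + (2*h)\<^sup>2 \<le> (l + 200 * b\<^sup>2 * D)\<^sup>2"
      by (simp add: power2_eq_square algebra_simps)
  qed (use that assms in auto)
  have "b * D \<le> 1/20 * D" using assms by (intro mult_right_mono) auto
  then have hD: "h \<le> D/15" using \<open>h \<le> 4/3 * b * D\<close> by linarith
  have pos: "0 \<le> 400 * b\<^sup>2 * D" using assms by simp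
  show ?thesis
  proof (cases "D/10 \<le> l1 \<and> D/10 \<le> l2")
    case True
    then show ?thesis using quad[of l1] quad[of l2] assms by (simp add: algebra_simps)
  next
    case False
    then have "l1 + l2 \<le> D/10 + D/2" using assms by auto
    moreover have "(1 + 400 * b\<^sup>2) * D = D + 400 * b\<^sup>2 * D" by (simp add: algebra_simps)
    ultimately show ?thesis
      using lin[OF \<open>0 \<le> l1\<close>] lin[OF \<open>0 \<le> l2\<close>] hD pos \<open>D > 0\<close> by linarith
  qed
qed

lemma flat_split:
  fixes Q :: "'a::euclidean_space set"
  assumes Q: "bounded Q" and L: "L \<in> lines" and h: "\<And>z. z \<in> Q \<Longrightarrow> infdist z L \<le> h"
    and hb: "0 \<le> h" "h \<le> 4/3 * b * diameter Q" and b: "0 \<le> b" "b \<le> 1/20"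
  shows "splits Q (1 + 400 * b\<^sup>2)"
proof (cases "diameter Q = 0")
  case True
  then show ?thesis unfolding splits_def by (intro exI[of _ "{Q}"]) auto
next
  case False
  define D where "D = diameter Q"
  have D: "D > 0" using False Q diameter_ge_0[of Q] by (simp add: D_def)
  then have ne: "Q \<noteq> {}" by (auto simp: D_def)
  obtain u where u: "norm u = 1"
    "\<And>z w. \<lbrakk>z \<in> Q; w \<in> Q\<rbrakk> \<Longrightarrow> (norm (z - w))\<^sup>2 \<le> (z \<bullet> u - w \<bullet> u)\<^sup>2 + (2*h)\<^sup>2"
    using lines_direction[OF L] h by metis
  define f where "f z = z \<bullet> u" for z
  have fD: "\<bar>f z - f w\<bar> \<le> D" if "z \<in> Q" "w \<in> Q" for z w
  proof -
    have "\<bar>f z - f w\<bar> \<le> norm (z - w) * norm u"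
      unfolding f_def inner_diff_left[symmetric] by (rule Cauchy_Schwarz_ineq2)
    also have "\<dots> \<le> D" using diameter_bounded_bound[OF Q that] u by (simp add: D_def dist_norm)
    finally show ?thesis .
  qed
  have bf: "bounded (f ` Q)"
    unfolding bounded_two_points by (intro exI[of _ D]) (auto simp: dist_real_def fD)
  define a where "a = Inf (f ` Q)"
  have a: "a \<le> f z" if "z \<in> Q" for z
    unfolding a_def using that bf by (intro cInf_lower) (auto intro: bounded_imp_bdd_below)
  have aD: "f z \<le> a + D" if "z \<in> Q" for z
  proof -
    have "f z - D \<le> a" unfolding a_def using ne
    proof (intro cInf_greatest)
      show "f z - D \<le> y" if "y \<in> f ` Q" for y
        using fD[OF \<open>z \<in> Q\<close>] that by (fastforce simp: abs_le_iff)
    qed auto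
    then show ?thesis by simp
  qed
  define Q1 where "Q1 = {z\<in>Q. f z \<le> a + D/2}"
  define Q2 where "Q2 = {z\<in>Q. f z > a + D/2}"
  define l where "l P = diameter (f ` P)" for P
  have sub: "Q1 \<subseteq> Q" "Q2 \<subseteq> Q" "Q1 \<union> Q2 = Q" "Q1 \<inter> Q2 = {}" by (auto simp: Q1_def Q2_def)
  have bP: "bounded (f ` P)" if "P \<subseteq> Q" for P using bf that by (meson bounded_subset image_mono)
  have l0: "0 \<le> l P" if "P \<subseteq> Q" for P unfolding l_def using bP[OF that] by (rule diameter_ge_0)
  have half: "diameter S \<le> D/2" if "S \<subseteq> {c..c + D/2}" for S c
  proof (rule diameter_le)
    fix x y assume "x \<in> S" "y \<in> S"
    then have "x \<in> {c..c + D/2}" "y \<in> {c..c + D/2}" using that by auto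
    then have "\<bar>x - y\<bar> \<le> D/2" unfolding atLeastAtMost_iff by linarith
    then show "norm (x - y) \<le> D/2" by simp
  qed (use D in auto)
  have l1: "l Q1 \<le> D/2" unfolding l_def
    by (rule half[of _ a]) (auto simp: Q1_def a)
  have l2: "l Q2 \<le> D/2" unfolding l_def
    by (rule half[of _ "a + D/2"]) (auto simp: Q2_def add.commute[of D] dest: aD)
  have "l Q1 \<le> D - l Q2"
    unfolding l_def[of Q1]
  proof (rule diameter_le)
    show "f ` Q1 \<noteq> {} \<or> 0 \<le> D - l Q2" using l2 D by auto
    fix x y assume "x \<in> f ` Q1" "y \<in> f ` Q1"
    then obtain x' y' where x: "x' \<in> Q1" "y' \<in> Q1" "x = f x'" "y = f y'" by auto
    have "l Q2 \<le> D - norm (x - y)"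
      unfolding l_def
    proof (rule diameter_le)
      have "norm (x - y) \<le> D" using fD[of x' y'] x sub by auto
      then show "f ` Q2 \<noteq> {} \<or> 0 \<le> D - norm (x - y)" by simp
      fix p q assume "p \<in> f ` Q2" "q \<in> f ` Q2"
      then obtain p' q' where p: "p' \<in> Q2" "q' \<in> Q2" "p = f p'" "q = f q'" by auto
      have "a \<le> x" "a \<le> y" "x \<le> a + D/2" "y \<le> a + D/2"
        using x a[of x'] a[of y'] by (auto simp: Q1_def)
      moreover have "a + D/2 < p" "a + D/2 < q" "p \<le> a + D" "q \<le> a + D"
        using p aD[of p'] aD[of q'] by (auto simp: Q2_def)
      ultimately show "norm (p - q) \<le> D - norm (x - y)"
        unfolding real_norm_def by linarith
    qed
    then show "norm (x - y) \<le> D - l Q2" by simp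
  qed
  then have l12: "l Q1 + l Q2 \<le> D" by simp
  have dP: "diameter P \<le> sqrt ((l P)\<^sup>2 + (2*h)\<^sup>2)" if P: "P \<subseteq> Q" for P
  proof (rule diameter_le)
    fix z w assume zw: "z \<in> P" "w \<in> P"
    have "\<bar>f z - f w\<bar> \<le> l P"
      unfolding l_def using diameter_bounded_bound[OF bP[OF P], of "f z" "f w"] zw by (simp add: dist_real_def)
    then have "(f z - f w)\<^sup>2 \<le> (l P)\<^sup>2" by (metis abs_ge_zero power2_abs power_mono)
    moreover have "z \<in> Q" "w \<in> Q" using zw P by auto
    ultimately have "(norm (z - w))\<^sup>2 \<le> (l P)\<^sup>2 + (2*h)\<^sup>2" using u(2)[of z w] unfolding f_def by linarith
    then show "norm (z - w) \<le> sqrt ((l P)\<^sup>2 + (2*h)\<^sup>2)" by (simp add: real_le_rsqrt)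
  qed auto
  have "b * D \<le> 1/20 * D" using D b by (intro mult_right_mono) auto
  then have hD: "h \<le> D/15" using hb(2)[folded D_def] by linarith
  have small: "sqrt (m\<^sup>2 + (2*h)\<^sup>2) \<le> 3/4 * D" if "0 \<le> m" "m \<le> D/2" for m
  proof (rule real_le_lsqrt)
    have "m\<^sup>2 \<le> (D/2)\<^sup>2" using that by (intro power_mono)
    moreover have "(2*h)\<^sup>2 \<le> (2*(D/15))\<^sup>2" using hD hb(1) by (intro power_mono) simp_all
    moreover have "(D/2)\<^sup>2 + (2*(D/15))\<^sup>2 \<le> (3/4 * D)\<^sup>2"
      using zero_le_power2[of D] by (simp add: power_divide power_mult_distrib)
    ultimately show "m\<^sup>2 + (2*h)\<^sup>2 \<le> (3/4 * D)\<^sup>2" by linarith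
  qed (use D in auto)
  have "diameter Q1 + diameter Q2 \<le> (1 + 400 * b\<^sup>2) * D"
    using half_lengths[OF l0[OF sub(1)] l0[OF sub(2)] l1 l2 l12 D hb(1) hb(2)[folded D_def] b]
      dP[OF sub(1)] dP[OF sub(2)] by linarith
  moreover have "(\<Sum>P\<in>{Q1,Q2}. diameter P) \<le> diameter Q1 + diameter Q2"
    using diameter_ge_0[OF bounded_subset[OF Q sub(1)]] by (cases "Q1 = Q2") simp_all
  moreover have "diameter P \<le> 3/4 * D" if "P \<in> {Q1,Q2}" for P
    using that dP[OF sub(1)] dP[OF sub(2)] small[OF l0[OF sub(1)] l1] small[OF l0[OF sub(2)] l2] by auto
  ultimately show ?thesis
    unfolding splits_def using sub by (intro exI[of _ "{Q1,Q2}"]) (auto simp: D_def)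
qed

lemma hausdorff_measure_limsup_eq_0:
  fixes A :: "'a::metric_space set"
  assumes s: "s > 1"
    and cover: "\<And>N. cheap_cover (E N) (\<delta> N) (c N)"
    and often: "\<And>x. x \<in> A \<Longrightarrow> \<exists>\<^sub>\<infinity>N. x \<in> E N"
    and \<delta>: "\<delta> \<longlonglongrightarrow> 0" "\<And>N. \<delta> N \<ge> 0"
    and summable: "summable (\<lambda>N. \<delta> N powr (s - 1) * c N)"
  shows "hausdorff_measure s A = 0"
proof -
  have "(INF U\<in>hausdorff_covers d A. \<Sum>i. hausdorff_gauge s (U i)) \<le> ennreal e" if "d > 0" "e > 0" for d e
  proof -
    obtain N1 where N1: "\<And>N. N \<ge> N1 \<Longrightarrow> norm (\<Sum>i. \<delta> (i + N) powr (s - 1) * c (i + N)) < e"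
      using suminf_exist_split[OF \<open>e > 0\<close> summable] by blast
    obtain N2 where N2: "\<And>N. N \<ge> N2 \<Longrightarrow> \<delta> N < d"
      using order_tendstoD(2)[OF \<delta>(1) \<open>d > 0\<close>] unfolding eventually_sequentially by blast
    define N0 where "N0 = max N1 N2"
    have "\<exists>xs. distinct xs \<and> E N \<subseteq> \<Union>(set xs) \<and> (\<forall>U\<in>set xs. bounded U \<and> diameter U \<le> \<delta> N) \<and>
        (\<Sum>U\<in>set xs. diameter U) \<le> c N" for N
      using cover[of N] unfolding cheap_cover_def by (metis finite_distinct_list)
    then obtain xs where xs: "\<And>N. distinct (xs N)" "\<And>N. E N \<subseteq> \<Union>(set (xs N))"
      "\<And>N U. U \<in> set (xs N) \<Longrightarrow> bounded U" "\<And>N U. U \<in> set (xs N) \<Longrightarrow> diameter U \<le> \<delta> N"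
      "\<And>N. (\<Sum>U\<in>set (xs N). diameter U) \<le> c N" by metis
    define V where "V = (\<lambda>(i,l). if l < length (xs (i + N0)) then xs (i + N0) ! l else {})"
    define W where "W k = V (prod_decode k)" for k
    have "A \<subseteq> (\<Union>k. W k)"
    proof
      fix x assume "x \<in> A"
      then obtain N where N: "N \<ge> N0" "x \<in> E N" using often unfolding INFM_nat_le by blast
      then obtain U where "U \<in> set (xs N)" "x \<in> U" using xs(2) by blast
      then obtain l where l: "l < length (xs N)" "x \<in> xs N ! l" by (metis in_set_conv_nth)
      then have "x \<in> V (N - N0, l)" using N by (simp add: V_def)
      then have "x \<in> W (prod_encode (N - N0, l))" by (simp add: W_def)
      then show "x \<in> (\<Union>k. W k)" by blast
    qed
    moreover have "bounded (V p) \<and> diameter (V p) \<le> d" for p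
    proof (cases p)
      case (Pair i l)
      have "\<delta> (i + N0) < d" by (rule N2) (simp add: N0_def)
      then show ?thesis using xs(3,4)[of _ "i + N0"] nth_mem[of l "xs (i + N0)"] \<open>d > 0\<close>
        by (fastforce simp: Pair V_def)
    qed
    ultimately have "W \<in> hausdorff_covers d A" by (simp add: hausdorff_covers_def W_def)
    moreover have "(\<Sum>k. hausdorff_gauge s (W k)) \<le> ennreal e"
    proof -
      let ?a = "\<lambda>N. \<delta> N powr (s - 1) * c N"
      have c0: "0 \<le> c N" for N
        using sum_nonneg[of "set (xs N)" diameter] xs(3)[of _ N] xs(5)[of N] diameter_ge_0 by force
      have row: "(\<Sum>l. hausdorff_gauge s (V (i, l))) \<le> ennreal (?a (i + N0))" for i
      proof -
        let ?xs = "xs (i + N0)"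
        have "(\<Sum>l. hausdorff_gauge s (V (i, l))) = (\<Sum>l<length ?xs. hausdorff_gauge s (V (i, l)))"
          by (rule suminf_finite) (auto simp: V_def hausdorff_gauge_def)
        also have "\<dots> = (\<Sum>l<length ?xs. hausdorff_gauge s (?xs ! l))"
          by (intro sum.cong) (auto simp: V_def)
        also have "\<dots> = (\<Sum>U\<in>set ?xs. hausdorff_gauge s U)"
          using xs(1) by (rule sum.reindex_bij_betw[OF bij_betw_nth]) auto
        also have "\<dots> \<le> (\<Sum>U\<in>set ?xs. ennreal (\<delta> (i + N0) powr (s - 1) * diameter U))"
        proof (rule sum_mono)
          fix U assume U: "U \<in> set ?xs"
          have "diameter U powr s = diameter U powr (s - 1) * diameter U powr 1"
            unfolding powr_add[symmetric] by simp
          also have "\<dots> = diameter U powr (s - 1) * diameter U"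
            using diameter_ge_0[OF xs(3)[OF U]] by simp
          also have "\<dots> \<le> \<delta> (i + N0) powr (s - 1) * diameter U"
            using xs(3,4)[OF U] s by (intro mult_right_mono powr_mono2) (auto simp: diameter_ge_0)
          finally show "hausdorff_gauge s U \<le> ennreal (\<delta> (i + N0) powr (s - 1) * diameter U)"
            using s by (simp add: hausdorff_gauge_def ennreal_leI)
        qed
        also have "\<dots> = ennreal (\<Sum>U\<in>set ?xs. \<delta> (i + N0) powr (s - 1) * diameter U)"
          using xs(3) by (intro sum_ennreal) (auto simp: diameter_ge_0)
        also have "\<dots> \<le> ennreal (?a (i + N0))"
          unfolding sum_distrib_left[symmetric] using xs(5) by (intro ennreal_leI mult_left_mono) auto
        finally show ?thesis .
      qed
      have "(\<Sum>k. hausdorff_gauge s (W k)) = (\<Sum>i. \<Sum>l. hausdorff_gauge s (V (i, l)))"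
        unfolding W_def by (rule suminf_ennreal_2dimen) simp
      also have "\<dots> \<le> (\<Sum>i. ennreal (?a (i + N0)))" by (intro suminf_le row) auto
      also have "\<dots> = ennreal (\<Sum>i. ?a (i + N0))"
        using summable c0 by (intro suminf_ennreal2) (auto simp: summable_iff_shift[of ?a])
      also have "\<dots> \<le> ennreal e" using N1[of N0] by (intro ennreal_leI) (simp add: N0_def)
      finally show ?thesis .
    qed
    ultimately show ?thesis by (meson INF_lower2)
  qed
  then have "(INF U\<in>hausdorff_covers d A. \<Sum>i. hausdorff_gauge s (U i)) = 0" if "d > 0" for d
    using that by (metis ennreal_le_epsilon add_0 le_zero_eq)
  then show ?thesis unfolding hausdorff_measure_def
    by (intro antisym SUP_least) auto
qed

lemma card_half_open_le:
  fixes a T :: real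
  assumes "T \<ge> 0"
  shows "finite {i::nat. a < i \<and> i \<le> a + T}" "card {i::nat. a < i \<and> i \<le> a + T} \<le> T + 1"
proof -
  have "inj_on int {i::nat. a < i \<and> i \<le> a + T}" by simp
  moreover have sub: "int ` {i::nat. a < i \<and> i \<le> a + T} \<subseteq> {\<lfloor>a\<rfloor><..\<lfloor>a + T\<rfloor>}"
    by (auto simp: floor_less_iff le_floor_iff)
  ultimately show "finite {i::nat. a < i \<and> i \<le> a + T}"
    by (meson finite_greaterThanAtMost_int inj_on_finite subset_refl image_subset_iff)
  have "card {i::nat. a < i \<and> i \<le> a + T} \<le> card {\<lfloor>a\<rfloor><..\<lfloor>a + T\<rfloor>}"
    using sub by (intro card_inj_on_le) auto
  moreover have "\<lfloor>a\<rfloor> \<le> \<lfloor>a + T\<rfloor>" using assms by (intro floor_mono) simp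
  ultimately show "card {i::nat. a < i \<and> i \<le> a + T} \<le> T + 1"
    by (simp add: nat_diff_distrib) linarith
qed

text \<open>
  Here \<open>\<Lambda> = (3/4)\<^sup>T\<close>, \<open>P m\<close> stands for flatness at the scale \<open>\<Lambda>\<^sup>m\<close> and \<open>good i\<close> for closeness to a
  line at the scale \<open>(3/4)\<^sup>i\<close>; the hypothesis relates the two if \<open>(3/4)\<^sup>i < \<Lambda>\<^sup>m \<le> (3/4)\<^sup>i 4/(3\<Lambda>)\<close>.
  The summand \<open>1\<close> accounts for \<open>i = 0\<close>, which no \<open>m\<close> controls.
\<close>

lemma card_exceptional_scales:
  fixes T :: real and N n :: nat and P good :: "nat \<Rightarrow> bool"
  assumes T: "T > 0" and n: "n \<le> N * T"
    and good: "\<And>i m. \<lbrakk>P m; m * T < i; i \<le> m * T + (T + 1)\<rbrakk> \<Longrightarrow> good i"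
  shows "card {i\<in>{0..<n}. \<not> good i} \<le> 1 + T * (T + 2) * card {m. m < N \<and> \<not> P m}"
proof -
  define X where "X = {i\<in>{1..<n}. \<not> good i}"
  define Y where "Y = {m. m < N \<and> \<not> P m}"
  define R where "R i m \<longleftrightarrow> m * T < i \<and> i \<le> m * T + (T + 1)" for i m :: nat
  have fin: "finite X" "finite Y" by (auto simp: X_def Y_def)
  have lower: "1/T \<le> card {m\<in>Y. R i m}" if i: "i \<in> X" for i
  proof -
    define p where "p = nat \<lceil>1/T\<rceil>"
    define c where "c = nat \<lceil>i/T\<rceil>"
    have p: "1/T \<le> p" "p < 1/T + 1" using T ceiling_correct[of "1/T"] by (auto simp: p_def)
    have c: "i/T \<le> c" "c < i/T + 1" using T ceiling_correct[of "i/T"] by (auto simp: c_def)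
    have "1/T \<le> i/T" using i T by (simp add: X_def divide_right_mono)
    then have pc: "p \<le> c" unfolding p_def c_def by (intro nat_mono ceiling_mono)
    have "{c - p..<c} \<subseteq> {m\<in>Y. R i m}"
    proof
      fix m assume m: "m \<in> {c - p..<c}"
      then have "real m + 1 \<le> c" "real c \<le> m + p" using pc by auto
      then have "real m < i/T" "i/T < real m + 1/T + 1" using p c by linarith+
      then have m': "m * T < i" "i < m * T + (T + 1)" using T by (auto simp: field_simps)
      have "i < n" using i by (auto simp: X_def)
      then have "m * T < N * T" using m' n by linarith
      then have "m < N" using T by simp
      moreover have "\<not> P m" using good[of m i] m' i by (auto simp: X_def)
      ultimately show "m \<in> {m\<in>Y. R i m}" using m' by (auto simp: Y_def R_def)
    qed
    then have "card {c - p..<c} \<le> card {m\<in>Y. R i m}" using fin by (intro card_mono) auto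
    then show ?thesis using p pc by simp
  qed
  have upper: "card {i\<in>X. R i m} \<le> T + 2" for m
  proof -
    have "card {i\<in>X. R i m} \<le> card {i::nat. m * T < i \<and> i \<le> m * T + (T + 1)}"
      using T by (intro card_mono card_half_open_le) (auto simp: R_def)
    then show ?thesis using card_half_open_le(2)[of "T + 1" "m * T"] T by linarith
  qed
  have "card X * (1/T) \<le> (\<Sum>i\<in>X. real (card {m\<in>Y. R i m}))"
    using lower by (intro sum_bounded_below)
  also have "(\<Sum>i\<in>X. real (card {m\<in>Y. R i m})) = (\<Sum>m\<in>Y. real (card {i\<in>X. R i m}))"
    unfolding of_nat_sum[symmetric] using fin
    by (intro arg_cong[where f = real] sum_multicount_gen) auto
  also have "\<dots> \<le> card Y * (T + 2)" using upper by (intro sum_bounded_above)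
  finally have "card X \<le> T * (T + 2) * card Y" using T by (simp add: field_simps)
  moreover have "card {i\<in>{0..<n}. \<not> good i} \<le> card (insert 0 X)"
    using fin by (intro card_mono) (auto simp: X_def)
  then have "card {i\<in>{0..<n}. \<not> good i} \<le> 1 + card X"
    using card_insert_le_m1 fin by (metis card_insert_if le_add2 le_trans order_refl plus_1_eq_Suc)
  ultimately show ?thesis unfolding Y_def by linarith
qed

lemma lines_nonempty: "(lines :: 'a::euclidean_space set set) \<noteq> {}"
proof -
  obtain e :: 'a where "norm e = 1" using vector_choose_size[of 1] by auto
  then have "affine hull {0, e} \<in> lines" by (auto simp: lines_def aff_dim_affine_hull)
  then show ?thesis by blast
qed

text \<open>The infimum over lines need not be attained, whence the factor \<open>2\<close>.\<close>

lemma flat_scaleE: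
  fixes K :: "'a::euclidean_space set"
  assumes K: "bounded K" and flat: "flat_scale K x \<beta> r" and \<beta>: "\<beta> > 0" and r: "r > 0"
  obtains L where "L \<in> lines" "\<And>z. \<lbrakk>z \<in> K; dist x z < r\<rbrakk> \<Longrightarrow> infdist z L \<le> 2 * \<beta> * r"
proof -
  have "(INF L\<in>lines. SUP z\<in>K \<inter> ball x r. infdist z L / r) < 2 * \<beta>"
    using flat \<beta> unfolding flat_scale_def beta_number_def by simp
  then obtain L where L: "L \<in> lines" "(SUP z\<in>K \<inter> ball x r. infdist z L / r) < 2 * \<beta>"
    using cInf_lessD[of "(\<lambda>L. SUP z\<in>K \<inter> ball x r. infdist z L / r) ` lines"] lines_nonempty by blast
  have "bdd_above ((\<lambda>z. infdist z L / r) ` (K \<inter> ball x r))"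
  proof (rule bdd_aboveI2)
    fix z assume "z \<in> K \<inter> ball x r"
    then have "infdist z L \<le> infdist x L + r" using infdist_triangle[of z L x] by (simp add: dist_commute)
    then show "infdist z L / r \<le> (infdist x L + r) / r" using r by (simp add: divide_right_mono)
  qed
  then have "infdist z L / r \<le> 2 * \<beta>" if "z \<in> K" "dist x z < r" for z
    using cSUP_upper[of z "K \<inter> ball x r" "\<lambda>z. infdist z L / r"] that L(2) by auto
  then show thesis using that L(1) r by (simp add: field_simps)
qed

definition near_line :: "'a::euclidean_space set \<Rightarrow> real \<Rightarrow> 'a \<Rightarrow> nat \<Rightarrow> bool" where
  "near_line K b x i \<longleftrightarrow> (\<exists>L\<in>lines. \<forall>z\<in>K. dist x z \<le> (3/4)^i \<longrightarrow> infdist z L \<le> b * (3/4)^i)"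

lemma near_line_cover:
  fixes K :: "'a::euclidean_space set"
  assumes K: "bounded K" "diameter K \<le> 1" and M: "M \<ge> 1" and b: "b \<ge> 0"
    and crude: "\<And>Q::'a set. bounded Q \<Longrightarrow> splits Q M"
  shows "cheap_cover {x\<in>K. card {i\<in>{0..<n}. \<not> near_line K b x i} \<le> t} ((3/4)^n)
    (M^t * (1 + 400 * M * b\<^sup>2)^n)"
proof -
  have "cheap_cover {x\<in>K. card {i\<in>{0..<0+n}. \<not> near_line K b x i} \<le> t} ((3/4)^(0+n))
    (M^t * (1 + 400 * M * b\<^sup>2)^n * diameter K)"
  proof (rule multiscale_cover[OF K(1) crude])
    fix Q x j
    assume Q: "Q \<subseteq> K" "x \<in> Q" "near_line K b x j" "(3/4)^(Suc j) < diameter Q" "diameter Q \<le> (3/4)^j"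
    have bQ: "bounded Q" using Q(1) K(1) bounded_subset by blast
    obtain L where L: "L \<in> lines" "\<And>z. \<lbrakk>z \<in> K; dist x z \<le> (3/4)^j\<rbrakk> \<Longrightarrow> infdist z L \<le> b * (3/4)^j"
      using Q(3) unfolding near_line_def by blast
    show "splits Q (1 + 400 * M * b\<^sup>2)"
    proof (cases "b \<le> 1/20")
      case True
      have "splits Q (1 + 400 * b\<^sup>2)"
      proof (rule flat_split[OF bQ L(1)])
        show "infdist z L \<le> b * (3/4)^j" if "z \<in> Q" for z
          using L(2)[of z] diameter_bounded_bound[OF bQ Q(2) that] that Q by auto
        have "b * (3/4)^j \<le> b * (4/3 * diameter Q)" using Q(4) b by (intro mult_left_mono) auto
        then show "b * (3/4)^j \<le> 4/3 * b * diameter Q" by simp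
      qed (use b True in auto)
      moreover have "b\<^sup>2 \<le> M * b\<^sup>2" using M mult_right_mono[of 1 M "b\<^sup>2"] by simp
      ultimately show ?thesis using splits_mono[OF _ _ bQ] by simp
    next
      case False
      then have "(1/20)\<^sup>2 \<le> b\<^sup>2" by (intro power_mono) auto
      then have "M * (1/20)\<^sup>2 \<le> M * b\<^sup>2" using M by (intro mult_left_mono) auto
      then show ?thesis by (intro splits_mono[OF crude[OF bQ] _ bQ]) (simp add: power2_eq_square)
    qed
  qed (use K M in auto)
  moreover have "M^t * (1 + 400 * M * b\<^sup>2)^n * diameter K \<le> M^t * (1 + 400 * M * b\<^sup>2)^n * 1"
    using K M by (intro mult_left_mono) auto
  ultimately show ?thesis unfolding add_0 mult_1_right by (meson cheap_cover_mono order_refl)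
qed

lemma cheap_cover_bound:
  fixes \<Lambda> \<kappa> \<beta> M \<epsilon> T X :: real and N n t :: nat
  assumes \<Lambda>: "0 < \<Lambda>" "\<Lambda> < 1" and T: "T = ln (1/\<Lambda>) / ln (4/3)" and M: "M \<ge> 1"
    and \<kappa>: "\<kappa> \<in> {0<..<1}" and \<beta>: "\<beta> > 0" "\<beta> < 1"
    and X: "X = \<Lambda> powi (-4) * (1 - \<kappa> + \<beta>\<^sup>2 * \<kappa>)"
    and \<epsilon>: "\<epsilon> = (ln M * (1 / ln (4/3) + 2) + 2845 * M + 1) / ln (4/3) * X"
    and n: "n \<le> N * T" "N * T \<le> n + 1" and t: "t \<le> 1 + T * (T + 2) * ((1 - \<kappa>) * N)"
  shows "((3/4)^n) powr \<epsilon> * (M^t * (1 + 400 * M * (8 * \<beta> / (3 * \<Lambda>))\<^sup>2)^n)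
    \<le> exp (ln M + ln (4/3) * \<epsilon>) * exp (- (T * X)) ^ N"
proof -
  define g where "g = ln (4/3 :: real)"
  define G where "G = ln M"
  define b where "b = 8 * \<beta> / (3 * \<Lambda>)"
  define w where "w = \<Lambda> powi (-4)"
  have g: "g > 0" by (simp add: g_def)
  have G: "G \<ge> 0" using M by (simp add: G_def)
  have w: "w = 1 / \<Lambda>^4" by (simp add: w_def power_int_minus divide_inverse)
  have T0: "T > 0" unfolding T g_def[symmetric] using \<Lambda> g by simp
  have w1: "1 \<le> w" using \<Lambda> by (simp add: w power_le_one)
  have "1/\<Lambda>^k \<le> w" if "k \<le> 4" for k
    unfolding w using \<Lambda> that by (intro divide_left_mono power_decreasing) auto
  from this[of 1] this[of 2] have w2: "1/\<Lambda> \<le> w" "1/\<Lambda>\<^sup>2 \<le> w" by auto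
  have "ln (1/\<Lambda>) \<le> 1/\<Lambda>" using ln_le_minus_one[of "1/\<Lambda>"] \<Lambda> by simp
  then have "T \<le> w / g" unfolding T g_def[symmetric] using g w2(1) by (intro divide_right_mono) auto
  then have Tw: "T + 2 \<le> (1/g + 2) * w" using w1 by (simp add: algebra_simps)
  have b2: "b\<^sup>2 = 64/9 * (\<beta>\<^sup>2 * (1/\<Lambda>\<^sup>2))" by (simp add: b_def power_divide power_mult_distrib)
  have \<kappa>\<beta>: "1 - \<kappa> \<le> 1 - \<kappa> + \<beta>\<^sup>2 * \<kappa>" "\<beta>\<^sup>2 \<le> 1 - \<kappa> + \<beta>\<^sup>2 * \<kappa>"
  proof -
    have "0 \<le> (1 - \<beta>\<^sup>2) * (1 - \<kappa>)" using \<kappa> \<beta> by (intro mult_nonneg_nonneg) (auto simp: power_le_one)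
    then show "\<beta>\<^sup>2 \<le> 1 - \<kappa> + \<beta>\<^sup>2 * \<kappa>" by (simp add: algebra_simps)
  qed (use \<kappa> in auto)
  have X0: "w * (1 - \<kappa>) \<le> X" "w * \<beta>\<^sup>2 \<le> X"
    unfolding X w_def[symmetric] using \<kappa>\<beta> w1 by (auto intro!: mult_left_mono)
  have "0 < w * (1 - \<kappa>)" using w1 \<kappa> by simp
  then have Xpos: "X > 0" using X0 by linarith
  have "(T + 2) * (1 - \<kappa>) \<le> (1/g + 2) * w * (1 - \<kappa>)" using Tw \<kappa> by (intro mult_right_mono) auto
  also have "\<dots> \<le> (1/g + 2) * X" unfolding mult.assoc using X0 g by (intro mult_left_mono) auto
  finally have "G * ((T + 2) * (1 - \<kappa>)) \<le> G * ((1/g + 2) * X)" using G by (intro mult_left_mono)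
  moreover have "b\<^sup>2 \<le> 64/9 * X"
  proof -
    have "\<beta>\<^sup>2 * (1/\<Lambda>\<^sup>2) \<le> \<beta>\<^sup>2 * w" using w2 by (intro mult_left_mono) auto
    then have "\<beta>\<^sup>2 * (1/\<Lambda>\<^sup>2) \<le> X" using X0(2) by (simp only: mult.commute)
    then show ?thesis unfolding b2 by (intro mult_left_mono) auto
  qed
  then have "400 * M * b\<^sup>2 \<le> 400 * M * (64/9 * X)" using M by (intro mult_left_mono) auto
  then have "400 * M * b\<^sup>2 \<le> 2845 * M * X" using M Xpos mult_pos_pos[of M X] by simp
  moreover have "g * \<epsilon> = (G * (1/g + 2) + 2845 * M + 1) * X"
    unfolding \<epsilon> g_def[symmetric] G_def[symmetric] using g by simp
  ultimately have gain: "G * ((T + 2) * (1 - \<kappa>)) + 400 * M * b\<^sup>2 - g * \<epsilon> \<le> - X"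
    by (simp add: algebra_simps)
  have \<epsilon>0: "\<epsilon> \<ge> 0" unfolding \<epsilon> g_def[symmetric] G_def[symmetric] using g G M Xpos by simp
  have "((3/4)^n :: real) = exp (- (g * n))"
    by (simp add: g_def exp_minus exp_of_nat2_mult power_inverse[symmetric])
  then have e1: "((3/4)^n) powr \<epsilon> = exp (- (g * \<epsilon>) * n)" by (simp add: powr_def mult_ac)
  have e2: "M^t = exp (G * t)" unfolding G_def exp_of_nat2_mult using M by simp
  have e3: "(1 + 400 * M * b\<^sup>2)^n \<le> exp (400 * M * b\<^sup>2 * n)"
    unfolding exp_of_nat2_mult using M by (intro power_mono exp_ge_add_one_self) auto
  have "((3/4)^n) powr \<epsilon> * (M^t * (1 + 400 * M * b\<^sup>2)^n)
      \<le> exp (- (g * \<epsilon>) * n) * (exp (G * t) * exp (400 * M * b\<^sup>2 * n))"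
    unfolding e1 e2 using e3 by (intro mult_left_mono) auto
  also have "\<dots> = exp (- (g * \<epsilon>) * n + G * t + 400 * M * b\<^sup>2 * n)"
    by (simp only: exp_add mult.assoc)
  also have "\<dots> \<le> exp (G + g * \<epsilon> + N * T * (- X))"
  proof (subst exp_le_cancel_iff)
    have "g * \<epsilon> * (N * T) \<le> g * \<epsilon> * (n + 1)" using n(2) g \<epsilon>0 by (intro mult_left_mono) auto
    moreover have "G * t \<le> G * (1 + T * (T + 2) * ((1 - \<kappa>) * N))" using t G by (intro mult_left_mono)
    moreover have "400 * M * b\<^sup>2 * n \<le> 400 * M * b\<^sup>2 * (N * T)" using n(1) M by (intro mult_left_mono) auto
    moreover have "N * T * (G * ((T + 2) * (1 - \<kappa>)) + 400 * M * b\<^sup>2 - g * \<epsilon>) \<le> N * T * (- X)"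
      using gain T0 by (intro mult_left_mono) auto
    ultimately show "- (g * \<epsilon>) * n + G * t + 400 * M * b\<^sup>2 * n \<le> G + g * \<epsilon> + N * T * (- X)"
      by (simp add: algebra_simps)
  qed
  also have "\<dots> = exp (G + g * \<epsilon>) * exp (- (T * X)) ^ N"
    unfolding exp_of_nat_mult[symmetric] exp_add[symmetric] by (simp add: mult_ac)
  finally show ?thesis unfolding b_def g_def G_def .
qed

theorem theorem4:
  assumes "CARD('n::finite) \<ge> 2"
  shows "\<exists>c'>0. \<forall>(K :: (real ^ 'n) set) \<Lambda> \<kappa> \<beta>\<^sub>0.
           bounded K \<and> diameter K = 1 \<and>
           \<Lambda> \<in> {0<..<1} \<and> \<kappa> \<in> {0<..<1} \<and> \<beta>\<^sub>0 \<in> {0<..<1} \<and>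
           (\<forall>x\<in>K. almost_flat_at K x \<Lambda> \<kappa> \<beta>\<^sub>0) \<longrightarrow>
           hausdorff_dim K \<le> ereal (1 + c' * \<Lambda> powi (-4) * (1 - \<kappa> + \<beta>\<^sub>0\<^sup>2 * \<kappa>))"
proof -
  obtain M where M: "M \<ge> 1" "\<And>Q::(real^'n) set. bounded Q \<Longrightarrow> splits Q M" using crude_split by blast
  define c' where "c' = (ln M * (1 / ln (4/3) + 2) + 2845 * M + 1) / ln (4/3)"
  have c': "c' > 0" unfolding c'_def using M(1) by (intro divide_pos_pos add_nonneg_pos add_nonneg_nonneg mult_nonneg_nonneg) auto
  have "hausdorff_dim K \<le> ereal (1 + c' * \<Lambda> powi (-4) * (1 - \<kappa> + \<beta>\<^sup>2 * \<kappa>))"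
    if K: "bounded K" "diameter K = 1" and \<Lambda>: "0 < \<Lambda>" "\<Lambda> < 1" and \<kappa>: "\<kappa> \<in> {0<..<1}" and \<beta>: "0 < \<beta>" "\<beta> < 1"
      and flat: "\<And>x. x \<in> K \<Longrightarrow> almost_flat_at K x \<Lambda> \<kappa> \<beta>"
    for K :: "(real^'n) set" and \<Lambda> \<kappa> \<beta>
  proof -
    define T where "T = ln (1/\<Lambda>) / ln (4/3)"
    define X where "X = \<Lambda> powi (-4) * (1 - \<kappa> + \<beta>\<^sup>2 * \<kappa>)"
    define \<epsilon> where "\<epsilon> = c' * X"
    define b where "b = 8 * \<beta> / (3 * \<Lambda>)"
    have T: "T > 0" using \<Lambda> by (simp add: T_def)
    have X: "X > 0" unfolding X_def using \<Lambda> \<kappa> by (intro mult_pos_pos add_pos_nonneg) auto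
    have \<epsilon>: "\<epsilon> > 0" using c' X by (simp add: \<epsilon>_def)
    have b: "b \<ge> 0" using \<Lambda> \<beta> by (simp add: b_def)
    define n where "n N = nat \<lfloor>N * T\<rfloor>" for N :: nat
    define t where "t N = nat \<lfloor>1 + T * (T + 2) * ((1 - \<kappa>) * N)\<rfloor>" for N :: nat
    define E where "E N = {x\<in>K. card {i\<in>{0..<n N}. \<not> near_line K b x i} \<le> t N}" for N
    have n: "n N \<le> N * T" "N * T \<le> n N + 1" for N
      using T floor_correct[of "N * T"] unfolding n_def by (simp_all add: add.commute)
    have t: "t N \<le> 1 + T * (T + 2) * ((1 - \<kappa>) * N)" for N
    proof -
      have "0 \<le> 1 + T * (T + 2) * ((1 - \<kappa>) * N)" using T \<kappa> by simp
      then show ?thesis unfolding t_def by (rule of_nat_floor)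
    qed
    have scale: "near_line K b x i"
      if "x \<in> K" and fl: "flat_scale K x \<beta> (\<Lambda> ^ m)" and im: "m * T < i" "i \<le> m * T + (T + 1)" for x i m
    proof -
      have \<Lambda>T: "ln \<Lambda> = - (T * ln (4/3))" using \<Lambda> by (simp add: T_def ln_div)
      have q: "ln (3/4 :: real) = - ln (4/3)" by (simp add: ln_div)
      have lt: "(3/4)^i < \<Lambda>^m"
      proof (subst ln_less_cancel_iff[symmetric])
        show "ln ((3/4)^i) < ln (\<Lambda>^m)"
          using im(1) \<Lambda> by (simp add: ln_realpow \<Lambda>T q mult.assoc[symmetric])
      qed (use \<Lambda> in auto)
      have le: "\<Lambda>^m * (3/4 * \<Lambda>) \<le> (3/4)^i"
      proof (subst ln_le_cancel_iff[symmetric])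
        have "i * ln (4/3) \<le> (m * T + (T + 1)) * ln (4/3 :: real)" using im(2) by (intro mult_right_mono) auto
        moreover have "ln (3/4 * \<Lambda>) = ln (3/4) + ln \<Lambda>" using \<Lambda> by (intro ln_mult_pos) auto
        moreover have "ln (\<Lambda>^m * (3/4 * \<Lambda>)) = ln (\<Lambda>^m) + ln (3/4 * \<Lambda>)"
          using \<Lambda> by (intro ln_mult_pos) auto
        moreover have "ln (\<Lambda>^m) = m * ln \<Lambda>" "ln ((3/4 :: real)^i) = i * ln (3/4)"
          using \<Lambda> by (simp_all add: ln_realpow)
        ultimately show "ln (\<Lambda>^m * (3/4 * \<Lambda>)) \<le> ln ((3/4)^i)"
          by (simp only: \<Lambda>T q) (simp add: algebra_simps)
      qed (use \<Lambda> in auto)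
      obtain L where L: "L \<in> lines" "\<And>z. \<lbrakk>z \<in> K; dist x z < \<Lambda>^m\<rbrakk> \<Longrightarrow> infdist z L \<le> 2 * \<beta> * \<Lambda>^m"
        using flat_scaleE[OF K(1) fl \<beta>(1)] \<Lambda> by auto
      have "2 * \<beta> * \<Lambda>^m = b * (\<Lambda>^m * (3/4 * \<Lambda>))" using \<Lambda> by (simp add: b_def)
      also have "\<dots> \<le> b * (3/4)^i" using le b by (intro mult_left_mono)
      finally show ?thesis unfolding near_line_def using L lt by (intro bexI[of _ L]) force+
    qed
    have "\<exists>\<^sub>\<infinity>N. x \<in> E N" if x: "x \<in> K" for x
    proof -
      obtain \<nu> :: "nat \<Rightarrow> nat" where \<nu>: "strict_mono \<nu>"
        "\<And>i. real (card {m. m < \<nu> i \<and> flat_scale K x \<beta> (\<Lambda> ^ m)}) > \<kappa> * real (\<nu> i)"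
        using flat[OF x] unfolding almost_flat_at_def by blast
      have "x \<in> E (\<nu> j)" for j
      proof -
        let ?N = "\<nu> j" and ?P = "\<lambda>m. flat_scale K x \<beta> (\<Lambda> ^ m)"
        have "card {m. m < ?N \<and> ?P m} + card {m. m < ?N \<and> \<not> ?P m} = card {..<?N}"
          by (subst card_Un_disjoint[symmetric]) (auto simp del: card_lessThan intro!: arg_cong[where f = card])
        then have "real (card {m. m < ?N \<and> ?P m}) + real (card {m. m < ?N \<and> \<not> ?P m}) = ?N"
          by (metis card_lessThan of_nat_add)
        then have "card {m. m < ?N \<and> \<not> ?P m} \<le> (1 - \<kappa>) * ?N"
          using \<nu>(2)[of j] by (simp add: algebra_simps)
        then have "T * (T + 2) * card {m. m < ?N \<and> \<not> ?P m} \<le> T * (T + 2) * ((1 - \<kappa>) * ?N)"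
          using T by (intro mult_left_mono) auto
        moreover have "card {i\<in>{0..<n ?N}. \<not> near_line K b x i}
            \<le> 1 + T * (T + 2) * card {m. m < ?N \<and> \<not> ?P m}"
          using T n(1) scale[OF x] by (rule card_exceptional_scales)
        ultimately have "card {i\<in>{0..<n ?N}. \<not> near_line K b x i} \<le> 1 + T * (T + 2) * ((1 - \<kappa>) * ?N)"
          by linarith
        then have "card {i\<in>{0..<n ?N}. \<not> near_line K b x i} \<le> t ?N"
          unfolding t_def by (rule le_nat_floor)
        then show "x \<in> E ?N" using x by (simp add: E_def)
      qed
      then show ?thesis unfolding INFM_nat_le using strict_mono_imp_increasing[OF \<nu>(1)] by blast
    qed
    moreover have "cheap_cover (E N) ((3/4)^n N) (M^t N * (1 + 400 * M * b\<^sup>2)^n N)" for N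
      unfolding E_def using K M b by (intro near_line_cover) auto
    moreover have "(\<lambda>N. (3/4 :: real)^n N) \<longlonglongrightarrow> 0"
    proof -
      have "filterlim (\<lambda>N. N * T) at_top sequentially"
        using T by (intro filterlim_at_top_mult_tendsto_pos[OF tendsto_const] filterlim_real_sequentially)
      then have "filterlim n at_top sequentially" unfolding n_def
        by (intro filterlim_compose[OF filterlim_nat_sequentially] filterlim_compose[OF filterlim_floor_sequentially])
      then show ?thesis by (rule filterlim_compose[OF LIMSEQ_realpow_zero, rotated 2]) auto
    qed
    moreover have "summable (\<lambda>N. ((3/4)^n N) powr (1 + \<epsilon> - 1) * (M^t N * (1 + 400 * M * b\<^sup>2)^n N))"
    proof (rule summable_comparison_test')
      show "summable (\<lambda>N. exp (ln M + ln (4/3) * \<epsilon>) * exp (- (T * X)) ^ N)"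
        using T X by (intro summable_mult summable_geometric) auto
      show "norm (((3/4)^n N) powr (1 + \<epsilon> - 1) * (M^t N * (1 + 400 * M * b\<^sup>2)^n N))
          \<le> exp (ln M + ln (4/3) * \<epsilon>) * exp (- (T * X)) ^ N" for N
        using cheap_cover_bound[OF \<Lambda> T_def M(1) \<kappa> \<beta> X_def \<epsilon>_def[unfolded c'_def] n t] M(1)
        by (simp add: b_def)
    qed
    ultimately have "hausdorff_measure (1 + \<epsilon>) K = 0"
      using \<epsilon> by (intro hausdorff_measure_limsup_eq_0[where E = E and \<delta> = "\<lambda>N. (3/4)^n N"
            and c = "\<lambda>N. M^t N * (1 + 400 * M * b\<^sup>2)^n N"]) auto
    then have "hausdorff_dim K \<le> ereal (1 + \<epsilon>)"
      unfolding hausdorff_dim_def using \<epsilon> by (intro INF_lower) auto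
    then show ?thesis by (simp add: \<epsilon>_def X_def mult.assoc)
  qed
  then show ?thesis using c' by (intro exI[of _ c']) auto
qed

end
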